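(* Let $q=t\in[0,1)$, $N\ge1$, $a_1,\dots,a_N>0$. For every $\boldsymbol h=(h^{(1)},\dots,h^{(N)})$ with $1\le h^{(k)}\le k$, the fundamental RSK-type `dynamics' $\mathsf{RSK}[\boldsymbol h]$ has nonnegative jump rates and probabilities of triggered moves (and so it is an honest Markov process): for every $k$ and all $\bar\nu\prec\lambda$ ($\bar\nu\in\mathbb{GT}_{k-1}$, $\lambda\in\mathbb{GT}_k$), the numbers $W_k(\lambda,\lambda+\mathrm e_m\,|\,\bar\nu)$ ($m\in\mathscr F$) and $V_k(\lambda,\lambda+\mathrm e_m\,|\,\bar\nu-\bar{\mathrm e}_j,\bar\nu)$ ($m,j+1\in\mathscr F$) are nonnegative.
   Context: **Signatures.** $\mathbb{GT}_k=\{\lambda\in\mathbb Z^k:\lambda_1\ge\dots\ge\lambda_k\}$, $\mathbb{GT}_0=\{\varnothing\}$. For $\bar\nu\in\mathbb{GT}_{k-1},\lambda\in\mathbb{GT}_k$, $\bar\nu\prec\lambda$ means $\lambda_{i+1}\le\bar\nu_i\le\lambda_i$ for $1\le i\le k-1$. $\mathrm e_j$, $\bar{\mathrm e}_i$ are standard basis vectors of $\mathbb Z^k$, $\mathbb Z^{k-1}$. For $\bar\nu\prec\lambda$ put $\mathscr F=\mathscr F(\bar\nu,\lambda)=\{j\in\{1,\dots,k\}:\lambda_j<\bar\nu_{j-1}\}$ ($\bar\nu_0=+\infty$) and $\xi(i)=\max\{j\le i:j\in\mathscr F\}$. **Macdonald quantities.** $(a;q)_\infty=\prod_{i\ge0}(1-aq^i)$,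 $f(u)=(tu;q)_\infty/(qu;q)_\infty$, $0^0=1$. For $\kappa\in\mathbb{GT}_{m-1}$, $\nu\in\mathbb{GT}_m$, $\kappa\prec\nu$: $\psi_{\nu/\kappa}=\prod_{1\le i\le j\le m-1}\frac{f(q^{\kappa_i-\kappa_j}t^{j-i})f(q^{\nu_i-\nu_{j+1}}t^{j-i})}{f(q^{\nu_i-\kappa_j}t^{j-i})f(q^{\kappa_i-\nu_{j+1}}t^{j-i})}$; $\psi_{\nu/\kappa}=0$ if $\kappa\not\prec\nu$ or if one of them is not a signature. For signatures $\mu,\mu+\mathrm e_j$: $\psi'_{\mu+\mathrm e_j/\mu}=\prod_{i=1}^{j-1}\frac{(1-q^{\mu_i-\mu_j}t^{j-i-1})(1-q^{\mu_i-\mu_j-1}t^{j-i+1})}{(1-q^{\mu_i-\mu_j}t^{j-i})(1-q^{\mu_i-\mu_j-1}t^{j-i})}$; zero if one of them is not a signature. (For $q=t$ all nonzero $\psi,\psi'$ equal $1$.) For $\bar\nu\prec\lambda$: $T_i=\frac{\psi_{\lambda/\bar\nu-\bar{\mathrm e}_i}}{\psi_{\lambda/\bar\nu}}\psi'_{\bar\nu/\bar\nu-\bar{\mathrm e}_i}$, $S_j=\frac{\psi_{\lambda+\mathrm e_j/\bar\nu}}{\psi_{\lambda/\bar\nu}}\psi'_{\lambda+\mathrm e_j/\lambda}$. **RSK-type fundamental `dynamics'.** $\mathsf{RSK}[\boldsymbol h]$ is the formal Markov evolution on interlacing arrays $\lambda^{(1)}\prec\dots\prec\lambda^{(N)}$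 determined by the following rates of independent jumps $W_k$ and probabilities of triggered moves $V_k$ on levels $k-1,k$ (with $h=h^{(k)}$): for $\bar\nu\prec\lambda$, $m\in\mathscr F$, $j+1\in\mathscr F$, $$W_k(\lambda,\lambda+\mathrm e_m|\bar\nu)=a_k1_{\xi(h)=m},\qquad V_k(\lambda,\lambda+\mathrm e_m|\bar\nu-\bar{\mathrm e}_j,\bar\nu)=r_j1_{m=\xi(j)}+(1-r_j)1_{m=j+1},$$ $$r_j=T_j^{-1}\bigl(S_1+\dots+S_j-T_1-\dots-T_{j-1}-1_{h\le j}\bigr)$$ ($T_j\neq0$ when $j+1\in\mathscr F$), $V_k(\lambda,\lambda|\bar\nu-\bar{\mathrm e}_j,\bar\nu)=0$; and $V_k(\lambda,\lambda+\mathrm e_j|\bar\nu-\bar{\mathrm e}_j,\bar\nu)=1$ if $\bar\nu\not\prec\lambda$, $\bar\nu-\bar{\mathrm e}_j\prec\lambda$, $\bar\nu\prec\lambda+\mathrm e_j$. At level $1$ the only jump is $\lambda\to\lambda+\mathrm e_1$ with rate $a_1$. *)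

theory Defs
  imports "HOL-Analysis.Analysis"
begin

text \<open>
  Signatures are integer lists; \<open>part lam i\<close> is the 1-based coordinate \<open>lam\<^sub>i\<close>, and all
  index sets below are 1-based.
\<close>

definition part :: "int list \<Rightarrow> nat \<Rightarrow> int" where
  "part lam i = lam ! (i - 1)"

definition GT :: "nat \<Rightarrow> int list set" where
  "GT k = {lam. length lam = k \<and> (\<forall>i\<in>{1..<k}. part lam (i + 1) \<le> part lam i)}"

definition add_e :: "int list \<Rightarrow> nat \<Rightarrow> int list" where
  "add_e lam j = lam[j - 1 := part lam j + 1]"

definition sub_e :: "int list \<Rightarrow> nat \<Rightarrow> int list" where
  "sub_e lam j = lam[j - 1 := part lam j - 1]"

definition interlaces :: "int list \<Rightarrow> int list \<Rightarrow> bool" where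
  "interlaces \<nu> lam \<longleftrightarrow>
     length lam = length \<nu> + 1 \<and> \<nu> \<in> GT (length \<nu>) \<and> lam \<in> GT (length lam) \<and>
     (\<forall>i\<in>{1..length \<nu>}. part lam (i + 1) \<le> part \<nu> i \<and> part \<nu> i \<le> part lam i)"

text \<open>The disjunct \<open>j = 1\<close> is the convention \<open>\<nu>\<^sub>0 = +\<infinity>\<close>.\<close>

definition free :: "int list \<Rightarrow> int list \<Rightarrow> nat set" where
  "free \<nu> lam = {j \<in> {1..length lam}. j = 1 \<or> part lam j < part \<nu> (j - 1)}"

definition \<xi> :: "int list \<Rightarrow> int list \<Rightarrow> nat \<Rightarrow> nat" where
  "\<xi> \<nu> lam i = Max {j \<in> free \<nu> lam. j \<le> i}"

definition qpoch_inf :: "real \<Rightarrow> real \<Rightarrow> real" where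
  "qpoch_inf a q = (\<Prod>i. 1 - a * q ^ i)"

definition macd_f :: "real \<Rightarrow> real \<Rightarrow> real \<Rightarrow> real" where
  "macd_f q t u = qpoch_inf (t * u) q / qpoch_inf (q * u) q"

definition \<psi> :: "real \<Rightarrow> real \<Rightarrow> int list \<Rightarrow> int list \<Rightarrow> real" where
  "\<psi> q t \<nu> \<kappa> =
     (if interlaces \<kappa> \<nu> then
        (\<Prod>i\<in>{1..length \<kappa>}. \<Prod>j\<in>{i..length \<kappa>}.
           (macd_f q t (q powi (part \<kappa> i - part \<kappa> j) * t ^ (j - i)) *
            macd_f q t (q powi (part \<nu> i - part \<nu> (j + 1)) * t ^ (j - i))) /
           (macd_f q t (q powi (part \<nu> i - part \<kappa> j) * t ^ (j - i)) *
            macd_f q t (q powi (part \<kappa> i - part \<nu> (j + 1)) * t ^ (j - i))))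
      else 0)"

text \<open>\<open>\<psi>' q t \<mu> j\<close> is \<open>\<psi>'\<close> for the skew diagram \<open>\<mu> + e\<^sub>j / \<mu>\<close>.\<close>

definition \<psi>' :: "real \<Rightarrow> real \<Rightarrow> int list \<Rightarrow> nat \<Rightarrow> real" where
  "\<psi>' q t \<mu> j =
     (if \<mu> \<in> GT (length \<mu>) \<and> add_e \<mu> j \<in> GT (length \<mu>) then
        (\<Prod>i\<in>{1..<j}.
           ((1 - q powi (part \<mu> i - part \<mu> j) * t ^ (j - i - 1)) *
            (1 - q powi (part \<mu> i - part \<mu> j - 1) * t ^ (j - i + 1))) /
           ((1 - q powi (part \<mu> i - part \<mu> j) * t ^ (j - i)) *
            (1 - q powi (part \<mu> i - part \<mu> j - 1) * t ^ (j - i))))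
      else 0)"

definition T_coef :: "real \<Rightarrow> real \<Rightarrow> int list \<Rightarrow> int list \<Rightarrow> nat \<Rightarrow> real" where
  "T_coef q t \<nu> lam i = \<psi> q t lam (sub_e \<nu> i) / \<psi> q t lam \<nu> * \<psi>' q t (sub_e \<nu> i) i"

definition S_coef :: "real \<Rightarrow> real \<Rightarrow> int list \<Rightarrow> int list \<Rightarrow> nat \<Rightarrow> real" where
  "S_coef q t \<nu> lam j = \<psi> q t (add_e lam j) \<nu> / \<psi> q t lam \<nu> * \<psi>' q t lam j"

definition r_coef :: "real \<Rightarrow> real \<Rightarrow> nat \<Rightarrow> int list \<Rightarrow> int list \<Rightarrow> nat \<Rightarrow> real" where
  "r_coef q t h \<nu> lam j =
     inverse (T_coef q t \<nu> lam j) *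
       ((\<Sum>i\<in>{1..j}. S_coef q t \<nu> lam i) - (\<Sum>i\<in>{1..<j}. T_coef q t \<nu> lam i) - of_bool (h \<le> j))"

text \<open>
  \<open>W a h lam lam' \<nu>\<close> is the rate of the independent jump \<open>lam \<rightarrow> lam'\<close> while the level below is \<open>\<nu>\<close>;
  \<open>V q t h lam lam' \<kappa> \<nu>\<close> is the probability that the move \<open>\<kappa> \<rightarrow> \<nu>\<close> of the level below
  triggers \<open>lam \<rightarrow> lam'\<close>.  Both vanish for all transitions not listed.  Each sum has at most one
  term whose guard \<open>lam' = add_e lam m\<close>, respectively \<open>\<kappa> = sub_e \<nu> j\<close>, holds.
  The index \<open>j\<close> runs over the coordinates of \<open>\<nu>\<close>, so the always free \<open>j + 1 = 1\<close> is excluded.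
  Level 1 is covered by \<open>W\<close> with \<open>\<nu> = []\<close>.
\<close>

definition W :: "real \<Rightarrow> nat \<Rightarrow> int list \<Rightarrow> int list \<Rightarrow> int list \<Rightarrow> real" where
  "W a h lam lam' \<nu> =
     (if interlaces \<nu> lam then
        (\<Sum>m\<in>free \<nu> lam. if lam' = add_e lam m then a * of_bool (\<xi> \<nu> lam h = m) else 0)
      else 0)"

definition V ::
  "real \<Rightarrow> real \<Rightarrow> nat \<Rightarrow> int list \<Rightarrow> int list \<Rightarrow> int list \<Rightarrow> int list \<Rightarrow> real" where
  "V q t h lam lam' \<kappa> \<nu> =
     (\<Sum>j\<in>{1..length \<nu>}. if \<kappa> = sub_e \<nu> j then
        (if interlaces \<nu> lam then
           (if j + 1 \<in> free \<nu> lam then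
              (\<Sum>m\<in>free \<nu> lam. if lam' = add_e lam m then
                 r_coef q t h \<nu> lam j * of_bool (m = \<xi> \<nu> lam j) +
                 (1 - r_coef q t h \<nu> lam j) * of_bool (m = j + 1) else 0)
            else 0)
         else of_bool (interlaces \<kappa> lam \<and> interlaces \<nu> (add_e lam j) \<and> lam' = add_e lam j))
      else 0)"

text \<open>An interlacing array is the list of its levels; level 0 is the empty signature.\<close>

definition level :: "int list list \<Rightarrow> nat \<Rightarrow> int list" where
  "level x k = (if k = 0 then [] else x ! (k - 1))"

definition arrays :: "nat \<Rightarrow> int list list set" where
  "arrays N = {x. length x = N \<and> (\<forall>k\<in>{1..N}. interlaces (level x (k - 1)) (level x k))}"

text \<open>
  Jump rate \<open>x \<rightarrow> y\<close> (\<open>x \<noteq> y\<close>) of \<open>RSK[h]\<close>: an independent jump at some level \<open>k\<close>, with the levels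
  below \<open>k\<close> unchanged, triggers moves successively at the levels \<open>k + 1, \<dots>, N\<close>.
\<close>

definition RSK ::
  "real \<Rightarrow> real \<Rightarrow> nat \<Rightarrow> (nat \<Rightarrow> real) \<Rightarrow> (nat \<Rightarrow> nat) \<Rightarrow>
   int list list \<Rightarrow> int list list \<Rightarrow> real" where
  "RSK q t N a h x y =
     (if length y = N then
        (\<Sum>k\<in>{1..N}.
           of_bool (\<forall>l\<in>{1..<k}. level y l = level x l) *
           W (a k) (h k) (level x k) (level y k) (level x (k - 1)) *
           (\<Prod>l\<in>{k<..N}. V q t (h l) (level x l) (level y l) (level x (l - 1)) (level y (l - 1))))
      else 0)"

text \<open>
  Off-diagonal rates \<open>Q\<close> of a continuous-time Markov chain on \<open>X\<close>: they are nonnegative and do not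
  lead out of \<open>X\<close>, and the total exit rates are finite and bounded, which excludes explosion.
\<close>

definition honest_markov_process :: "'s set \<Rightarrow> ('s \<Rightarrow> 's \<Rightarrow> real) \<Rightarrow> bool" where
  "honest_markov_process X Q \<longleftrightarrow>
     (\<forall>x\<in>X. \<forall>y\<in>X. y \<noteq> x \<longrightarrow> 0 \<le> Q x y) \<and>
     (\<forall>x\<in>X. \<forall>y. y \<notin> X \<longrightarrow> Q x y = 0) \<and>
     (\<exists>C. \<forall>x\<in>X. Q x summable_on (X - {x}) \<and> infsum (Q x) (X - {x}) \<le> C)"

end

theory Submission
  imports Defs
begin

text \<open>
  For \<open>q = t\<close> every nonzero \<open>\<psi>\<close> and \<open>\<psi>'\<close> equals 1, so \<open>S\<^sub>j\<close> and \<open>T\<^sub>i\<close> are the indicators of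
  \<open>j \<in> F\<close> and \<open>i + 1 \<in> F\<close>.  The sum in \<open>r\<^sub>j\<close> telescopes to \<open>S\<^sub>1 = 1\<close>, hence \<open>r\<^sub>j\<close> is the indicator
  of \<open>j < h\<close> and all triggering probabilities lie in \<open>[0, 1]\<close>.  Every transition of positive rate
  adds at most one unit vector on each level and preserves the interlacing, which bounds the
  number of targets, and therefore the exit rates, uniformly.
\<close>

section \<open>Unit shifts of signatures, interlacing and the free set\<close>

lemma part_add_e:
  assumes "1 \<le> i" "1 \<le> j" "j \<le> length lam"
  shows "part (add_e lam j) i = part lam i + of_bool (i = j)"
proof (cases "i = j")
  case False
  then have "j - 1 \<noteq> i - 1" using assms by linarith
  then show ?thesis using False by (simp add: part_def add_e_def)
qed (use assms in \<open>simp add: part_def add_e_def\<close>)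

lemma part_sub_e:
  assumes "1 \<le> i" "1 \<le> j" "j \<le> length lam"
  shows "part (sub_e lam j) i = part lam i - of_bool (i = j)"
proof (cases "i = j")
  case False
  then have "j - 1 \<noteq> i - 1" using assms by linarith
  then show ?thesis using False by (simp add: part_def sub_e_def)
qed (use assms in \<open>simp add: part_def sub_e_def\<close>)

lemma length_add_e [simp]: "length (add_e lam j) = length lam"
  by (simp add: add_e_def)

lemma length_sub_e [simp]: "length (sub_e lam j) = length lam"
  by (simp add: sub_e_def)

lemma add_e_sub_e:
  assumes "1 \<le> j" "j \<le> length lam"
  shows "add_e (sub_e lam j) j = lam"
  using assms by (simp add: add_e_def sub_e_def part_def)

lemma inj_on_add_e: "inj_on (add_e lam) {1..length lam}"
proof (rule inj_onI)
  fix i j assume "i \<in> {1..length lam}" "j \<in> {1..length lam}" "add_e lam i = add_e lam j"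
  then show "i = j"
    using part_add_e[of i i lam] part_add_e[of i j lam] by (auto split: if_splits)
qed

lemma inj_on_sub_e: "inj_on (sub_e lam) {1..length lam}"
proof (rule inj_onI)
  fix i j assume "i \<in> {1..length lam}" "j \<in> {1..length lam}" "sub_e lam i = sub_e lam j"
  then show "i = j"
    using part_sub_e[of i i lam] part_sub_e[of i j lam] by (auto split: if_splits)
qed

lemma GT_antimono:
  assumes "\<mu> \<in> GT k" "1 \<le> i" "i \<le> j" "j \<le> k"
  shows "part \<mu> j \<le> part \<mu> i"
  using assms(3,4)
proof (induction j rule: dec_induct)
  case (step n)
  have "part \<mu> (n + 1) \<le> part \<mu> n"
    using assms(1,2) step by (auto simp: GT_def)
  with step show ?case by simp
qed simp

text \<open>Consecutive inequalities chain through the other row, so the interlacing inequalities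
  force both rows to be weakly decreasing. Interlacing can thus be checked coordinate by
  coordinate.\<close>

lemma interlaces_iff:
  "interlaces \<nu> lam \<longleftrightarrow> length lam = length \<nu> + 1 \<and>
     (\<forall>i\<in>{1..length \<nu>}. part lam (i + 1) \<le> part \<nu> i \<and> part \<nu> i \<le> part lam i)"
  (is "_ \<longleftrightarrow> ?len \<and> ?le")
proof (intro iffI)
  assume R: "?len \<and> ?le"
  have "part \<nu> (i + 1) \<le> part \<nu> i" if "i \<in> {1..<length \<nu>}" for i
  proof -
    have "part \<nu> (i + 1) \<le> part lam (i + 1)" "part lam (i + 1) \<le> part \<nu> i"
      using R that by auto
    then show ?thesis by simp
  qed
  moreover have "part lam (i + 1) \<le> part lam i" if "i \<in> {1..<length lam}" for i
  proof -
    have "part lam (i + 1) \<le> part \<nu> i" "part \<nu> i \<le> part lam i"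
      using R that by auto
    then show ?thesis by simp
  qed
  ultimately show "interlaces \<nu> lam"
    using R by (auto simp: interlaces_def GT_def)
qed (auto simp: interlaces_def)

lemma free_subset: "free \<nu> lam \<subseteq> {1..length lam}"
  by (auto simp: free_def)

lemma finite_free [simp]: "finite (free \<nu> lam)"
  using free_subset by (rule finite_subset) simp

text \<open>Raising \<open>lam\<close> at j endangers only the bound by coordinate j - 1 of
  \<open>\<nu>\<close>, which survives a unit step exactly when it is strict. For j = 1 there is no
  such bound.\<close>

lemma interlaces_add_e_iff:
  assumes I: "interlaces \<nu> lam" and j: "j \<in> {1..length lam}"
  shows "interlaces \<nu> (add_e lam j) \<longleftrightarrow> j \<in> free \<nu> lam"
proof
  assume J: "interlaces \<nu> (add_e lam j)"
  show "j \<in> free \<nu> lam"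
  proof (cases "j = 1")
    case False
    then have "j - 1 \<in> {1..length \<nu>}" using I j by (auto simp: interlaces_iff)
    then have "part (add_e lam j) (j - 1 + 1) \<le> part \<nu> (j - 1)"
      using J by (auto simp: interlaces_iff)
    then show ?thesis using j False by (simp add: part_add_e free_def)
  qed (use j in \<open>simp add: free_def\<close>)
next
  assume J: "j \<in> free \<nu> lam"
  have "part (add_e lam j) (i + 1) \<le> part \<nu> i \<and> part \<nu> i \<le> part (add_e lam j) i"
    if "i \<in> {1..length \<nu>}" for i
  proof -
    have "part lam (i + 1) \<le> part \<nu> i" "part \<nu> i \<le> part lam i"
      using I that by (auto simp: interlaces_iff)
    moreover have "part lam (i + 1) < part \<nu> i" if "i + 1 = j"
      using J that \<open>i \<in> _\<close> by (auto simp: free_def)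
    ultimately show ?thesis
      using that j by (auto simp: part_add_e)
  qed
  then show "interlaces \<nu> (add_e lam j)"
    using I by (auto simp: interlaces_iff)
qed

text \<open>Lowering \<open>\<nu>\<close> at j endangers only the lower bound by coordinate j + 1 of
  \<open>lam\<close>; hence the shift of index against the previous lemma.\<close>

lemma interlaces_sub_e_iff:
  assumes I: "interlaces \<nu> lam" and j: "j \<in> {1..length \<nu>}"
  shows "interlaces (sub_e \<nu> j) lam \<longleftrightarrow> j + 1 \<in> free \<nu> lam"
proof
  assume J: "interlaces (sub_e \<nu> j) lam"
  then have "part lam (j + 1) \<le> part (sub_e \<nu> j) j"
    using j by (auto simp: interlaces_iff)
  then show "j + 1 \<in> free \<nu> lam"
    using I j by (auto simp: part_sub_e free_def interlaces_iff)
next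
  assume J: "j + 1 \<in> free \<nu> lam"
  have "part lam (i + 1) \<le> part (sub_e \<nu> j) i \<and> part (sub_e \<nu> j) i \<le> part lam i"
    if "i \<in> {1..length \<nu>}" for i
  proof -
    have "part lam (i + 1) \<le> part \<nu> i" "part \<nu> i \<le> part lam i"
      using I that by (auto simp: interlaces_iff)
    moreover have "part lam (i + 1) < part \<nu> i" if "i = j"
      using J that j by (auto simp: free_def)
    ultimately show ?thesis
      using that j by (auto simp: part_sub_e)
  qed
  then show "interlaces (sub_e \<nu> j) lam"
    using I by (auto simp: interlaces_iff)
qed

section \<open>The Macdonald quantities at \<open>q = t\<close>\<close>

text \<open>The deviations of the factors from 1 form a geometric series, so the product converges
  absolutely, and no factor vanishes because a < 1. This rules out 0/0 in
  \<open>macd_f\<close>.\<close>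

lemma qpoch_inf_nonzero:
  assumes "0 \<le> a" "a < 1" "0 \<le> q" "q < 1"
  shows "qpoch_inf a q \<noteq> 0"
proof -
  have "summable (\<lambda>i. norm ((1 - a * q ^ i) - 1))"
    using assms by (simp add: summable_mult abs_mult power_abs summable_geometric)
  then have "convergent_prod (\<lambda>i. 1 - a * q ^ i)"
    by (intro abs_convergent_prod_imp_convergent_prod)
       (simp add: abs_convergent_prod_conv_summable)
  moreover have "1 - a * q ^ i \<noteq> 0" for i
  proof -
    have "a * q ^ i \<le> a * 1"
      using assms by (intro mult_left_mono power_le_one) auto
    then show ?thesis using assms by auto
  qed
  ultimately show ?thesis
    unfolding qpoch_inf_def by (rule prodinf_nonzero)
qed

text \<open>At q = t the numerator and denominator of f coincide; they are nonzero since the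
  argument is a nonnegative power of t.\<close>

lemma macd_f_eq_1:
  assumes "0 \<le> t" "t < 1" "0 \<le> d"
  shows "macd_f t t (t powi d * t ^ n) = 1"
proof -
  have "t powi d * t ^ n = t ^ (nat d + n)"
    using assms by (simp add: power_int_def power_add)
  moreover have "t * t ^ (nat d + n) \<le> t * 1"
    using assms by (intro mult_left_mono power_le_one) auto
  ultimately show ?thesis
    using assms qpoch_inf_nonzero[of "t * t ^ (nat d + n)" t] by (simp add: macd_f_def)
qed

lemma \<psi>_eq:
  assumes t: "0 \<le> t" "t < 1"
  shows "\<psi> t t lam \<nu> = of_bool (interlaces \<nu> lam)"
proof (cases "interlaces \<nu> lam")
  case True
  have factor: "(macd_f t t (t powi (part \<nu> i - part \<nu> j) * t ^ (j - i)) *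
         macd_f t t (t powi (part lam i - part lam (j + 1)) * t ^ (j - i))) /
        (macd_f t t (t powi (part lam i - part \<nu> j) * t ^ (j - i)) *
         macd_f t t (t powi (part \<nu> i - part lam (j + 1)) * t ^ (j - i))) = 1"
    if "i \<in> {1..length \<nu>}" "j \<in> {i..length \<nu>}" for i j
  proof -
    \<comment> \<open>These three inequalities make all four exponents in the factor nonnegative, so
      each f equals 1.\<close>
    have "part \<nu> j \<le> part \<nu> i"
      using True that by (auto simp: interlaces_def intro!: GT_antimono)
    moreover have "part lam (j + 1) \<le> part \<nu> j" "part \<nu> i \<le> part lam i"
      using True that by (auto simp: interlaces_def)
    ultimately show ?thesis
      using t by (simp add: macd_f_eq_1)
  qed
  show ?thesis
    unfolding \<psi>_def by (simp only: True if_True of_bool_eq) (intro prod.neutral ballI factor)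
qed (simp add: \<psi>_def)

text \<open>Write the difference of parts as m + 1 and j - i as n + 1. At q = t the exponents in the
  numerator are m + n + 1 and m + n + 2, and the denominator has the same two in reverse
  order.\<close>

lemma \<psi>'_eq:
  assumes t: "0 \<le> t" "t < 1" and j: "1 \<le> j" "j \<le> length \<mu>"
  shows "\<psi>' t t \<mu> j = of_bool (\<mu> \<in> GT (length \<mu>) \<and> add_e \<mu> j \<in> GT (length \<mu>))"
proof (cases "\<mu> \<in> GT (length \<mu>) \<and> add_e \<mu> j \<in> GT (length \<mu>)")
  case True
  have factor: "((1 - t powi (part \<mu> i - part \<mu> j) * t ^ (j - i - 1)) *
         (1 - t powi (part \<mu> i - part \<mu> j - 1) * t ^ (j - i + 1))) /
        ((1 - t powi (part \<mu> i - part \<mu> j) * t ^ (j - i)) *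
         (1 - t powi (part \<mu> i - part \<mu> j - 1) * t ^ (j - i))) = 1"
    if i: "i \<in> {1..<j}" for i
  proof -
    \<comment> \<open>Since the raised row is still a signature, the original parts at i and j
      differ by at least 1.\<close>
    have "part (add_e \<mu> j) j \<le> part (add_e \<mu> j) i"
      using True i j by (intro GT_antimono[of _ "length \<mu>"]) auto
    then have "1 \<le> part \<mu> i - part \<mu> j"
      using i j by (simp add: part_add_e)
    then obtain m where m: "part \<mu> i - part \<mu> j = int (Suc m)"
      by (metis Suc_le_D nat_int_comparison(3) of_nat_1 zero_le_imp_eq_int
          order_trans zero_le_one One_nat_def)
    obtain n where n: "j - i = Suc n"
      using i by (metis Suc_diff_Suc atLeastLessThan_iff)
    have pw: "t powi (int (Suc m)) = t ^ Suc m" "t powi (int (Suc m) - 1) = t ^ m"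
      by (simp_all only: power_int_of_nat) (simp_all add: power_int_def)
    \<comment> \<open>Positive exponents keep the denominator away from zero, also for t =
      0.\<close>
    have "t ^ Suc k < 1" for k
      using t power_le_one[of t k] mult_left_mono[of "t ^ k" 1 t] by simp
    then have "t ^ Suc (m + n) \<noteq> 1" "t ^ Suc (Suc (m + n)) \<noteq> 1"
      by (metis less_irrefl)+
    then show ?thesis
      unfolding m n pw by (simp add: power_add [symmetric] del: power_Suc)
  qed
  show ?thesis
    unfolding \<psi>'_def by (simp only: True if_True of_bool_eq simp_thms) (intro prod.neutral ballI factor)
qed (auto simp: \<psi>'_def)

text \<open>The ratio of \<open>\<psi>\<close> values tests whether the lowered row still
  interlaces. If it does, it is a signature and raising it back gives \<open>\<nu>\<close>, so the
  \<open>\<psi>'\<close> factor is 1.\<close>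

lemma T_coef_eq:
  assumes "0 \<le> t" "t < 1" "interlaces \<nu> lam" "i \<in> {1..length \<nu>}"
  shows "T_coef t t \<nu> lam i = of_bool (i + 1 \<in> free \<nu> lam)"
proof -
  have "\<nu> \<in> GT (length \<nu>)"
    using assms by (simp add: interlaces_def)
  moreover have "sub_e \<nu> i \<in> GT (length \<nu>)" if "interlaces (sub_e \<nu> i) lam"
    using that by (simp add: interlaces_def)
  ultimately show ?thesis
    using assms interlaces_sub_e_iff[of \<nu> lam i]
    by (auto simp: T_coef_def \<psi>_eq \<psi>'_eq add_e_sub_e)
qed

lemma S_coef_eq:
  assumes "0 \<le> t" "t < 1" "interlaces \<nu> lam" "j \<in> {1..length lam}"
  shows "S_coef t t \<nu> lam j = of_bool (j \<in> free \<nu> lam)"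
proof -
  have "lam \<in> GT (length lam)"
    using assms unfolding interlaces_def by blast
  moreover have "add_e lam j \<in> GT (length lam)" if "interlaces \<nu> (add_e lam j)"
    using that by (auto simp: interlaces_def)
  ultimately show ?thesis
    using assms interlaces_add_e_iff[of \<nu> lam j]
    by (auto simp: S_coef_def \<psi>_eq \<psi>'_eq)
qed

lemma r_coef_eq:
  assumes t: "0 \<le> t" "t < 1" and I: "interlaces \<nu> lam"
    and j: "j \<in> {1..length \<nu>}" "j + 1 \<in> free \<nu> lam"
  shows "r_coef t t h \<nu> lam j = of_bool (j < h)"
proof -
  have len: "length lam = length \<nu> + 1"
    using I by (simp add: interlaces_def)
  have "(\<Sum>i\<in>{1..j}. S_coef t t \<nu> lam i) = (\<Sum>i\<in>{1..<Suc j}. of_bool (i \<in> free \<nu> lam))"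
    using j len by (intro sum.cong) (auto simp: S_coef_eq[OF t I])
  \<comment> \<open>The index 1 is always free and contributes the surviving 1. After a shift of
    index the other S terms are the indicators that give T at 1, ..., j - 1.\<close>
  also have "\<dots> = of_bool (1 \<in> free \<nu> lam) + (\<Sum>i\<in>{Suc 1..<Suc j}. of_bool (i \<in> free \<nu> lam))"
    using j by (intro sum.atLeast_Suc_lessThan) auto
  also have "\<dots> = 1 + (\<Sum>i\<in>{1..<j}. of_bool (i + 1 \<in> free \<nu> lam))"
    using len by (subst sum.shift_bounds_Suc_ivl) (simp add: free_def)
  also have "(\<Sum>i\<in>{1..<j}. of_bool (i + 1 \<in> free \<nu> lam)) = (\<Sum>i\<in>{1..<j}. T_coef t t \<nu> lam i)"
    using j by (intro sum.cong) (auto simp: T_coef_eq[OF t I])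
  \<comment> \<open>What remains is 1 minus the indicator of \<open>h \<le> j\<close>, divided by T
    at j, which is 1 because j + 1 is free.\<close>
  finally show ?thesis
    using j by (simp add: r_coef_def T_coef_eq[OF t I])
qed

section \<open>Jump rates and triggered moves\<close>

text \<open>Injectivity lets at most one guard hold, so a bound on a single term bounds the whole
  sum, whatever the size of A. Both \<open>W\<close> and \<open>V\<close> have this shape.\<close>

lemma sum_if_inj_bounds:
  fixes g :: "'a \<Rightarrow> real"
  assumes "inj_on f A" "finite A" "\<And>j. j \<in> A \<Longrightarrow> 0 \<le> g j \<and> g j \<le> c" "0 \<le> c"
  shows "(\<Sum>j\<in>A. if y = f j then g j else 0) \<in> {0..c}"
proof (cases "\<exists>i\<in>A. y = f i")
  case True
  then obtain i where i: "i \<in> A" "y = f i" by blast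
  have "(\<Sum>j\<in>A. if y = f j then g j else 0) = (\<Sum>j\<in>A. if j = i then g j else 0)"
    using assms(1) i by (intro sum.cong) (auto dest: inj_onD)
  then show ?thesis
    using assms i by simp
next
  case False
  then have "(\<Sum>j\<in>A. if y = f j then g j else 0) = 0"
    by (intro sum.neutral) auto
  then show ?thesis using assms by simp
qed

lemma W_bounds:
  assumes "0 \<le> a"
  shows "W a h lam lam' \<nu> \<in> {0..a}"
  using assms sum_if_inj_bounds[OF inj_on_subset[OF inj_on_add_e free_subset] finite_free,
      where g = "\<lambda>m. a * of_bool (\<xi> \<nu> lam h = m)" and c = a and y = lam']
  by (auto simp: W_def)

lemma V_bounds:
  assumes t: "0 \<le> t" "t < 1"
  shows "V t t h lam lam' \<kappa> \<nu> \<in> {0..1}"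
  unfolding V_def
proof (rule sum_if_inj_bounds[OF inj_on_sub_e])
  fix j assume j: "j \<in> {1..length \<nu>}"
  let ?s = "\<Sum>m\<in>free \<nu> lam. if lam' = add_e lam m
     then r_coef t t h \<nu> lam j * of_bool (m = \<xi> \<nu> lam j) +
          (1 - r_coef t t h \<nu> lam j) * of_bool (m = j + 1) else 0"
  \<comment> \<open>The coefficient r is 0 or 1, so each term reduces to a single indicator.\<close>
  have "?s \<in> {0..1}" if "interlaces \<nu> lam" "j + 1 \<in> free \<nu> lam"
    using r_coef_eq[OF t that(1) j that(2)]
    by (intro sum_if_inj_bounds inj_on_subset[OF inj_on_add_e free_subset]) auto
  then show "0 \<le> (if interlaces \<nu> lam then if j + 1 \<in> free \<nu> lam then ?s else 0
      else of_bool (interlaces \<kappa> lam \<and> interlaces \<nu> (add_e lam j) \<and> lam' = add_e lam j)) \<and>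
    (if interlaces \<nu> lam then if j + 1 \<in> free \<nu> lam then ?s else 0
      else of_bool (interlaces \<kappa> lam \<and> interlaces \<nu> (add_e lam j) \<and> lam' = add_e lam j)) \<le> 1"
    by auto
qed auto

lemma W_nonzeroD:
  assumes "W a h lam lam' \<nu> \<noteq> 0"
  shows "interlaces \<nu> lam' \<and> (\<exists>m\<in>{1..length lam}. lam' = add_e lam m)"
proof -
  have I: "interlaces \<nu> lam"
    using assms by (auto simp: W_def split: if_splits)
  then obtain m where "m \<in> free \<nu> lam" "lam' = add_e lam m"
    using assms by (auto simp: W_def split: if_splits elim!: sum.not_neutral_contains_not_neutral)
  then show ?thesis
    using I free_subset[of \<nu> lam] by (auto simp: interlaces_add_e_iff)
qed

text \<open>Only the guards matter: a push at a free index preserves interlacing, and in the forced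
  case interlacing with the new row is part of the guard itself.\<close>

lemma V_nonzeroD:
  assumes "V q t h lam lam' \<kappa> \<nu> \<noteq> 0"
  shows "interlaces \<nu> lam' \<and> (\<exists>m\<in>{1..length lam}. lam' = add_e lam m)"
proof -
  obtain j where j: "j \<in> {1..length \<nu>}"
    and nz: "(if interlaces \<nu> lam then
           (if j + 1 \<in> free \<nu> lam then
              (\<Sum>m\<in>free \<nu> lam. if lam' = add_e lam m then
                 r_coef q t h \<nu> lam j * of_bool (m = \<xi> \<nu> lam j) +
                 (1 - r_coef q t h \<nu> lam j) * of_bool (m = j + 1) else 0)
            else 0)
         else of_bool (interlaces \<kappa> lam \<and> interlaces \<nu> (add_e lam j) \<and> lam' = add_e lam j)) \<noteq> 0"
    using assms unfolding V_def
    by (elim sum.not_neutral_contains_not_neutral) (metis (no_types, lifting))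
  show ?thesis
  proof (cases "interlaces \<nu> lam")
    case True
    then obtain m where "m \<in> free \<nu> lam" "lam' = add_e lam m"
      using nz by (auto split: if_splits elim!: sum.not_neutral_contains_not_neutral)
    then show ?thesis
      using True free_subset[of \<nu> lam] by (auto simp: interlaces_add_e_iff)
  next
    case False
    then have "interlaces \<nu> (add_e lam j)" "lam' = add_e lam j"
      using nz by auto
    \<comment> \<open>Interlacing makes \<open>lam\<close> one longer than \<open>\<nu>\<close>, so
      a coordinate of \<open>\<nu>\<close> is one of \<open>lam\<close>.\<close>
    moreover from this have "j \<in> {1..length lam}"
      using j by (auto simp: interlaces_def)
    ultimately show ?thesis by blast
  qed
qed

section \<open>Exit rates\<close>

text \<open>The summand for k is a rate in [0, a_k] times factors in [0, 1].\<close>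

lemma RSK_bounds:
  assumes t: "0 \<le> t" "t < 1" and a: "\<forall>k\<in>{1..N}. 0 < a k"
  shows "RSK t t N a h x y \<in> {0..\<Sum>k\<in>{1..N}. a k}"
proof -
  let ?w = "\<lambda>k. of_bool (\<forall>l\<in>{1..<k}. level y l = level x l) *
     W (a k) (h k) (level x k) (level y k) (level x (k - 1))"
  let ?v = "\<lambda>k. \<Prod>l\<in>{k<..N}.
     V t t (h l) (level x l) (level y l) (level x (l - 1)) (level y (l - 1))"
  have "0 \<le> ?w k * ?v k \<and> ?w k * ?v k \<le> a k" if k: "k \<in> {1..N}" for k
  proof -
    have "0 \<le> ?w k" "?w k \<le> a k"
      using a k W_bounds[of "a k"] by (auto simp: order.strict_implies_order)
    moreover have "0 \<le> ?v k" "?v k \<le> 1"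
      using V_bounds[OF t] by (auto intro!: prod_nonneg prod_le_1)
    ultimately show ?thesis
      using mult_mono[of "?w k" "a k" "?v k" 1] by auto
  qed
  moreover have "0 \<le> (\<Sum>k\<in>{1..N}. a k)"
    using a by (intro sum_nonneg) (simp add: order.strict_implies_order)
  ultimately show ?thesis
    by (auto simp: RSK_def intro!: sum_nonneg sum_mono)
qed

text \<open>Some summand k is nonzero: levels below k stay, level k moves through \<open>W\<close>,
  and those above through \<open>V\<close>. Each move interlaces with the already updated level
  below.\<close>

lemma RSK_nonzeroD:
  assumes x: "x \<in> arrays N" and nz: "RSK q t N a h x y \<noteq> 0"
  shows "y \<in> arrays N"
    and "l \<in> {1..N} \<Longrightarrow> level y l = level x l \<or> (\<exists>m\<in>{1..l}. level y l = add_e (level x l) m)"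
proof -
  have len: "length (level x l) = l" if "l \<le> N" for l
    using that
  proof (induction l)
    case (Suc l)
    then show ?case using x by (force simp: arrays_def interlaces_def)
  qed (simp add: level_def)
  have leny: "length y = N"
    using nz by (auto simp: RSK_def split: if_splits)
  obtain k where k: "k \<in> {1..N}"
    and low: "\<forall>l\<in>{1..<k}. level y l = level x l"
    and w: "W (a k) (h k) (level x k) (level y k) (level x (k - 1)) \<noteq> 0"
    and v: "\<And>l. l \<in> {k<..N} \<Longrightarrow>
      V q t (h l) (level x l) (level y l) (level x (l - 1)) (level y (l - 1)) \<noteq> 0"
    using nz by (auto simp: RSK_def split: if_splits elim!: sum.not_neutral_contains_not_neutral)
  \<comment> \<open>Level 0 is included, where both sides are the empty signature; this is the level
    below when k = 1.\<close>
  have low': "level y l = level x l" if "l < k" for l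
    using low that by (cases "l = 0") (auto simp: level_def)
  have *: "interlaces (level y (l - 1)) (level y l) \<and>
      (level y l = level x l \<or> (\<exists>m\<in>{1..l}. level y l = add_e (level x l) m))"
    if l: "l \<in> {1..N}" for l
  proof (cases l k rule: linorder_cases)
    case less
    moreover have "interlaces (level x (l - 1)) (level x l)"
      using x l by (auto simp: arrays_def)
    ultimately show ?thesis by (simp add: low')
  next
    case equal
    then show ?thesis using W_nonzeroD[OF w] k len[of l] l by (simp add: low')
  next
    case greater
    then show ?thesis using V_nonzeroD[OF v[of l]] len[of l] l by auto
  qed
  show "y \<in> arrays N"
    using leny * by (auto simp: arrays_def)
  show "l \<in> {1..N} \<Longrightarrow> level y l = level x l \<or> (\<exists>m\<in>{1..l}. level y l = add_e (level x l) m)"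
    using * by blast
qed

text \<open>A target is determined by one choice per level: stay, or raise one of at most N
  coordinates. The count is independent of x, which makes the exit rates uniformly bounded.\<close>

lemma RSK_targets:
  assumes x: "x \<in> arrays N"
  shows "finite {y. RSK q t N a h x y \<noteq> 0}" "card {y. RSK q t N a h x y \<noteq> 0} \<le> (N + 1) ^ N"
proof -
  let ?G = "{..<N} \<rightarrow>\<^sub>E {..N}"
  \<comment> \<open>The code 0 means that a level stays; m > 0 means that coordinate m is raised.
    List position i holds level i + 1.\<close>
  let ?F = "\<lambda>g. map (\<lambda>i. if g i = 0 then x ! i else add_e (x ! i) (g i)) [0..<N]"
  have sub: "{y. RSK q t N a h x y \<noteq> 0} \<subseteq> ?F ` ?G"
  proof safe
    fix y assume nz: "RSK q t N a h x y \<noteq> 0"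
    then have len: "length y = N"
      by (auto simp: RSK_def split: if_splits)
    have "\<exists>m\<in>{..N}. y ! i = (if m = 0 then x ! i else add_e (x ! i) m)" if "i < N" for i
    proof -
      from RSK_nonzeroD(2)[OF x nz, of "i + 1"] that
      consider "y ! i = x ! i" | m where "m \<in> {1..i + 1}" "y ! i = add_e (x ! i) m"
        by (auto simp: level_def)
      then show ?thesis
      proof cases
        case 1
        then show ?thesis by (intro bexI[of _ 0]) auto
      next
        case 2
        then show ?thesis using that by (intro bexI[of _ m]) auto
      qed
    qed
    then obtain g where
      g: "\<And>i. i < N \<Longrightarrow> g i \<in> {..N} \<and> y ! i = (if g i = 0 then x ! i else add_e (x ! i) (g i))"
      by metis
    have "y = ?F (restrict g {..<N})"
      using g len by (intro nth_equalityI) auto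
    moreover have "restrict g {..<N} \<in> ?G"
      using g by auto
    ultimately show "y \<in> ?F ` ?G" by blast
  qed
  have fin: "finite ?G" by (intro finite_PiE) auto
  then show "finite {y. RSK q t N a h x y \<noteq> 0}"
    using sub by (meson finite_imageI finite_subset)
  have "card {y. RSK q t N a h x y \<noteq> 0} \<le> card (?F ` ?G)"
    using sub fin by (intro card_mono) auto
  also have "\<dots> \<le> card ?G"
    using fin by (rule card_image_le)
  also have "\<dots> = (N + 1) ^ N"
    by (simp add: card_PiE)
  finally show "card {y. RSK q t N a h x y \<noteq> 0} \<le> (N + 1) ^ N" .
qed

lemma honest_markov_process_RSK:
  assumes t: "0 \<le> t" "t < 1" and a: "\<forall>k\<in>{1..N}. 0 < a k"
  shows "honest_markov_process (arrays N) (RSK t t N a h)"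
proof -
  let ?Q = "RSK t t N a h" and ?A = "\<Sum>k\<in>{1..N}. a k"
  have exit: "?Q x summable_on (arrays N - {x}) \<and>
      infsum (?Q x) (arrays N - {x}) \<le> real ((N + 1) ^ N) * ?A"
    if x: "x \<in> arrays N" for x
  proof -
    \<comment> \<open>The infinite sum lives on this finite support, where it is at most the number
      of targets times the largest possible rate.\<close>
    let ?Y = "{y. ?Q x y \<noteq> 0} \<inter> (arrays N - {x})"
    have fin: "finite ?Y" using RSK_targets(1)[OF x] by blast
    have "?Q x summable_on ?Y" using fin by simp
    then have "?Q x summable_on (arrays N - {x})"
      by (subst (asm) summable_on_cong_neutral[where T = "arrays N - {x}" and g = "?Q x"]) auto
    moreover have "infsum (?Q x) (arrays N - {x}) = infsum (?Q x) ?Y"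
      by (intro infsum_cong_neutral) auto
    moreover have "infsum (?Q x) ?Y = sum (?Q x) ?Y" using fin by simp
    moreover have "sum (?Q x) ?Y \<le> real (card ?Y) * ?A"
      using RSK_bounds[OF t a] by (intro sum_bounded_above) auto
    moreover have "card ?Y \<le> (N + 1) ^ N"
      using RSK_targets[OF x] by (meson Int_lower1 card_mono order_trans)
    moreover have "0 \<le> ?A"
      using a by (intro sum_nonneg) (simp add: order.strict_implies_order)
    ultimately show ?thesis
      by (smt (verit) mult_right_mono of_nat_le_iff)
  qed
  show ?thesis
    unfolding honest_markov_process_def
  proof (intro conjI)
    show "\<forall>x\<in>arrays N. \<forall>y\<in>arrays N. y \<noteq> x \<longrightarrow> 0 \<le> ?Q x y"
      using RSK_bounds[OF t a] by auto
    show "\<forall>x\<in>arrays N. \<forall>y. y \<notin> arrays N \<longrightarrow> ?Q x y = 0"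
      using RSK_nonzeroD(1) by blast
    show "\<exists>C. \<forall>x\<in>arrays N. ?Q x summable_on (arrays N - {x}) \<and>
        infsum (?Q x) (arrays N - {x}) \<le> C"
      using exit by blast
  qed
qed

theorem proposition7p1:
  fixes q t :: real and N :: nat and a :: "nat \<Rightarrow> real" and h :: "nat \<Rightarrow> nat"
  assumes "q = t" and "0 \<le> t" and "t < 1" and "1 \<le> N"
    and "\<forall>k\<in>{1..N}. 0 < a k"
    and "\<forall>k\<in>{1..N}. 1 \<le> h k \<and> h k \<le> k"
  shows "(\<forall>k\<in>{1..N}. \<forall>\<nu>\<in>GT (k - 1). \<forall>lam\<in>GT k. interlaces \<nu> lam \<longrightarrow>
            (\<forall>m\<in>free \<nu> lam. 0 \<le> W (a k) (h k) lam (add_e lam m) \<nu>) \<and>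
            (\<forall>m\<in>free \<nu> lam. \<forall>j\<in>{1..k - 1}. j + 1 \<in> free \<nu> lam \<longrightarrow>
               0 \<le> V q t (h k) lam (add_e lam m) (sub_e \<nu> j) \<nu>)) \<and>
         honest_markov_process (arrays N) (RSK q t N a h)"
proof -
  have "0 \<le> W (a k) (h k) lam lam' \<nu>" if "k \<in> {1..N}" for k lam lam' \<nu>
    using W_bounds[of "a k"] assms(5) that by (simp add: order.strict_implies_order)
  moreover have "0 \<le> V q t (h k) lam lam' \<kappa> \<nu>" for k lam lam' \<kappa> \<nu>
    using V_bounds[OF assms(2,3)] \<open>q = t\<close> by simp
  ultimately show ?thesis
    using honest_markov_process_RSK[OF assms(2,3,5)] \<open>q = t\<close> by blast
qed

end
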